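(* Let $(X,d)$ be a compact metric space and let $\mathbb S$ be the semigroup action induced on $(X,d)$ by a finite family of continuous maps $(g_i\colon X\to X)_{i=1}^p$. (a) If a Borel probability measure $\nu$ on $X$ is strongly $G$-homogeneous, then for every $x\in X$ $$\overline{\mathrm{mdim}}^{GLW}_M\big(X,\mathbb S,d\big)=\limsup_{\varepsilon\to0^+}\frac{h^G_\nu(x,\varepsilon)}{-\log\varepsilon}.$$ (b) Let $\nu$ be a nonzero Borel measure on $X$ and $s\in(0,\infty)$. If $\inf_{x\in X}\overline{\mathrm{mdim}}'_\nu(x,d)\ge s$, then $\overline{\mathrm{mdim}}^{GLW}_M\big(X,\mathbb S,d\big)\ge s$.
   Context: $G$ is the semigroup generated by $G_1=\{g_1,\dots,g_p\}$ under composition; $G_0=\{\mathrm{id}\}$ and, for $n\ge1$, $G_n$ is the set of compositions of $n$ elements of $G_1$. Standing assumption: $G_1$ is minimal, i.e. no generator is a composition of the remaining ones. GLW metric mean dimension. A set $E\subset X$ is $(n,\varepsilon)$-separated by elements of $\mathbb S$ if for any $x\ne y$ in $E$ there exist $0\le j\le n$ and $g\in G_j$ with $d(g(x),g(y))>\varepsilon$; $s(n,\varepsilon)$ is the largest cardinality of such a set. Put $h_{GLW}(\mathbb S,\varepsilon)=\limsup_{n\to\infty}\frac1n\log s(n,\varepsilon)$ and $\overline{\mathrm{mdim}}^{GLW}_M(X,\mathbb S,d)=\limsup_{\varepsilon\to0^+}\frac{h_{GLW}(\mathbb S,\varepsilon)}{-\log\varepsilon}$. Local entropies. $B^G_n(x,\varepsilon)=\{y\in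 X:d(g(x),g(y))<\varepsilon\text{ for all }g\in G_j,\ 0\le j\le n\}$. For a Borel measure $\nu$ on $X$, $h^G_\nu(x,\varepsilon)=\limsup_{n\to\infty}-\frac1n\log\nu(B^G_n(x,\varepsilon))$, $h_{\nu,G}(x,\varepsilon)=\liminf_{n\to\infty}-\frac1n\log\nu(B^G_n(x,\varepsilon))$ (with $-\log0=+\infty$), and $\overline{\mathrm{mdim}}'_\nu(x,d)=\limsup_{\varepsilon\to0^+}\frac{h_{\nu,G}(x,\varepsilon)}{-\log\varepsilon}$. $G$-homogeneity. A Borel measure $\nu$ on $X$ is $G$-homogeneous if: $\nu(K)<\infty$ for every compact $K\subset X$; there is $K_0\subset X$ with $\nu(K_0)>0$; and for every $\varepsilon>0$ there exist $\delta(\varepsilon)>0$ and $c>0$ such that $\nu(B^G_n(x,\delta(\varepsilon)))\le c\,\nu(B^G_n(y,\varepsilon))$ for all $n\in\mathbb N$ and all $x,y\in X$. It is strongly $G$-homogeneous if in addition $\delta(\varepsilon)=O(\varepsilon)$.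
   Formalization: In strong G-homogeneity, δ(ε)=O(ε) is read as: δ(ε) is of exact order ε as ε→0+ (bounded above and below by multiples of ε); with only the upper bound every homogeneous measure qualifies and (a) is false. *)

theory Defs
  imports "HOL-Probability.Probability" "HOL-Library.Landau_Symbols"
begin

text \<open>
  The compact metric space is a type of class \<^class>\<open>metric_space\<close> with compact universe, its
  metric being \<^const>\<open>dist\<close>; \<open>S\<close> is the generating set of the semigroup.
\<close>

primrec compositions :: "('a \<Rightarrow> 'a) set \<Rightarrow> nat \<Rightarrow> ('a \<Rightarrow> 'a) set" where
  "compositions S 0 = {id}"
| "compositions S (Suc n) = {f \<circ> h | f h. f \<in> S \<and> h \<in> compositions S n}"

text \<open>Only nonempty compositions count here, so the identity may itself be a generator.\<close>

definition minimal_generators :: "('a \<Rightarrow> 'a) set \<Rightarrow> bool" where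
  "minimal_generators S \<longleftrightarrow> (\<forall>f\<in>S. \<forall>n\<ge>1. f \<notin> compositions (S - {f}) n)"

definition separated_by ::
  "('a::metric_space \<Rightarrow> 'a) set \<Rightarrow> nat \<Rightarrow> real \<Rightarrow> 'a set \<Rightarrow> bool" where
  "separated_by S n \<epsilon> E \<longleftrightarrow>
     (\<forall>x\<in>E. \<forall>y\<in>E. x \<noteq> y \<longrightarrow> (\<exists>j\<le>n. \<exists>g\<in>compositions S j. dist (g x) (g y) > \<epsilon>))"

text \<open>
  If the space is compact, the generators are finitely many continuous maps and \<open>\<epsilon> > 0\<close>, then
  separated sets are finite, of bounded cardinality, so this supremum of naturals is a maximum.
\<close>

definition max_separated :: "('a::metric_space \<Rightarrow> 'a) set \<Rightarrow> nat \<Rightarrow> real \<Rightarrow> nat" where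
  "max_separated S n \<epsilon> = Sup {card E | E. finite E \<and> separated_by S n \<epsilon> E}"

text \<open>The entropies can be infinite, whence the extended reals.\<close>

definition entropy_GLW :: "('a::metric_space \<Rightarrow> 'a) set \<Rightarrow> real \<Rightarrow> ereal" where
  "entropy_GLW S \<epsilon> = limsup (\<lambda>n. ereal (1 / real n * ln (real (max_separated S n \<epsilon>))))"

definition upper_mdim_GLW :: "('a::metric_space \<Rightarrow> 'a) set \<Rightarrow> ereal" where
  "upper_mdim_GLW S = Limsup (at_right 0) (\<lambda>\<epsilon>. entropy_GLW S \<epsilon> / ereal (- ln \<epsilon>))"

definition dyn_ball ::
  "('a::metric_space \<Rightarrow> 'a) set \<Rightarrow> nat \<Rightarrow> 'a \<Rightarrow> real \<Rightarrow> 'a set" where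
  "dyn_ball S n x \<epsilon> = {y. \<forall>j\<le>n. \<forall>g\<in>compositions S j. dist (g x) (g y) < \<epsilon>}"

definition elog :: "ennreal \<Rightarrow> ereal" where
  "elog t = (if t = 0 then - \<infinity> else if t = \<infinity> then \<infinity> else ereal (ln (enn2real t)))"

definition upper_local_entropy ::
  "('a::metric_space \<Rightarrow> 'a) set \<Rightarrow> 'a measure \<Rightarrow> 'a \<Rightarrow> real \<Rightarrow> ereal" where
  "upper_local_entropy S \<nu> x \<epsilon> =
     limsup (\<lambda>n. - (ereal (1 / real n) * elog (emeasure \<nu> (dyn_ball S n x \<epsilon>))))"

definition lower_local_entropy ::
  "('a::metric_space \<Rightarrow> 'a) set \<Rightarrow> 'a measure \<Rightarrow> 'a \<Rightarrow> real \<Rightarrow> ereal" where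
  "lower_local_entropy S \<nu> x \<epsilon> =
     liminf (\<lambda>n. - (ereal (1 / real n) * elog (emeasure \<nu> (dyn_ball S n x \<epsilon>))))"

definition upper_local_mdim ::
  "('a::metric_space \<Rightarrow> 'a) set \<Rightarrow> 'a measure \<Rightarrow> 'a \<Rightarrow> ereal" where
  "upper_local_mdim S \<nu> x =
     Limsup (at_right 0) (\<lambda>\<epsilon>. lower_local_entropy S \<nu> x \<epsilon> / ereal (- ln \<epsilon>))"

definition homogeneous_with ::
  "('a::metric_space \<Rightarrow> 'a) set \<Rightarrow> 'a measure \<Rightarrow> (real \<Rightarrow> real) \<Rightarrow> bool" where
  "homogeneous_with S \<nu> \<delta> \<longleftrightarrow>
     (\<forall>K. compact K \<longrightarrow> emeasure \<nu> K < \<infinity>) \<and>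
     (\<exists>K\<^sub>0. emeasure \<nu> K\<^sub>0 > 0) \<and>
     (\<forall>\<epsilon>>0. \<delta> \<epsilon> > 0 \<and>
        (\<exists>c>0. \<forall>n x y. emeasure \<nu> (dyn_ball S n x (\<delta> \<epsilon>))
                           \<le> ennreal c * emeasure \<nu> (dyn_ball S n y \<epsilon>)))"

definition homogeneous :: "('a::metric_space \<Rightarrow> 'a) set \<Rightarrow> 'a measure \<Rightarrow> bool" where
  "homogeneous S \<nu> \<longleftrightarrow> (\<exists>\<delta>. homogeneous_with S \<nu> \<delta>)"

text \<open>
  The condition usually written \<open>\<delta>(\<epsilon>) = O(\<epsilon>)\<close> is read as: \<open>\<delta>(\<epsilon>)\<close> is of the order of \<open>\<epsilon>\<close>, as
  \<open>\<epsilon>\<close> tends to 0. An upper bound alone would be void, since \<^const>\<open>homogeneous_with\<close> is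
  preserved when \<open>\<delta>\<close> is replaced by a smaller positive function, so that every homogeneous measure
  would satisfy it.
\<close>

definition strongly_homogeneous :: "('a::metric_space \<Rightarrow> 'a) set \<Rightarrow> 'a measure \<Rightarrow> bool" where
  "strongly_homogeneous S \<nu> \<longleftrightarrow>
     (\<exists>\<delta>. homogeneous_with S \<nu> \<delta> \<and> \<delta> \<in> \<Theta>[at_right 0](\<lambda>\<epsilon>. \<epsilon>))"

end

theory Submission
  imports Defs "HOL-Real_Asymp.Real_Asymp"
begin

text \<open>
  A maximal \<open>(n, \<epsilon>)\<close>-separated set has pairwise disjoint dynamical balls of radius \<open>\<epsilon> / 2\<close>, whereas
  those of any larger radius than \<open>\<epsilon>\<close> cover the space. Homogeneity makes all these balls comparable
  with the one around a fixed point, so both counts turn into entropy inequalities, off by a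
  bounded factor in the radius, which is invisible after division by \<open>- ln \<epsilon>\<close>.

  For the second part, restrict to the radii \<open>exp (- k)\<close>. If the entropies of the action at
  scale \<open>exp (- k) / 2\<close> were smaller than \<open>t * k\<close> for all large \<open>k\<close>, then the points whose local
  entropy at scale \<open>exp (- k)\<close> exceeds \<open>t * k\<close> would be covered by few balls of tiny measure, hence
  form a null set; but countably many of these sets exhaust the space.
\<close>

section \<open>Extended reals\<close>

text \<open>If \<open>L\<close> is a finite number \<open>l\<close>, the factor
  \<open>1 + e / (1 + l)\<close> adds at most \<open>e\<close> to it; the denominator is
  \<open>1 + l\<close> because \<open>l\<close> may be 0.\<close>

lemma ereal_le_if_le_mult_greater_one:
  fixes X L :: ereal
  assumes "0 \<le> L" and le: "\<And>r. 1 < r \<Longrightarrow> X \<le> ereal r * L"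
  shows "X \<le> L"
proof (cases L)
  case (real l)
  show ?thesis
  proof (rule ereal_le_epsilon2)
    fix e :: real assume "0 < e"
    have "0 \<le> l" using assms(1) real by simp
    have "X \<le> ereal (1 + e / (1 + l)) * L"
      using \<open>0 < e\<close> \<open>0 \<le> l\<close> by (intro le) (simp add: field_simps)
    also have "\<dots> \<le> L + ereal e"
      using \<open>0 < e\<close> \<open>0 \<le> l\<close> by (simp add: real field_simps)
    finally show "X \<le> L + ereal e" .
  qed
qed (use assms in auto)

lemma ereal_divide_right_antimono_pos:
  fixes a :: ereal
  assumes "0 \<le> a" "0 < c" "c \<le> b"
  shows "a / ereal b \<le> a / ereal c"
  using assms by (cases a) (auto simp: frac_le)

text \<open>The ratio of \<open>- ln (a * \<epsilon>)\<close> to \<open>- ln \<epsilon>\<close>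
  tends to 1, so for small \<epsilon> exchanging them costs at most any prescribed factor
  \<open>r > 1\<close>. Nonnegativity of \<open>F\<close> makes the quotients antitone in the
  denominator.\<close>

lemma Limsup_rescale_div_ln_le:
  fixes F :: "real \<Rightarrow> ereal"
  assumes "0 < a" and nonneg: "\<And>\<epsilon>. 0 < \<epsilon> \<Longrightarrow> 0 \<le> F \<epsilon>"
  shows "Limsup (at_right 0) (\<lambda>\<epsilon>. F (a * \<epsilon>) / ereal (- ln \<epsilon>))
         \<le> Limsup (at_right 0) (\<lambda>\<epsilon>. F \<epsilon> / ereal (- ln \<epsilon>))" (is "?X \<le> ?L")
proof (rule ereal_le_if_le_mult_greater_one)
  have small: "\<forall>\<^sub>F \<epsilon> in at_right (0::real). 0 < \<epsilon> \<and> \<epsilon> < b" if "0 < b" for b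
    using eventually_at_right_real[OF that] by simp
  show "0 \<le> ?L"
    by (intro le_Limsup eventually_mono[OF small[of 1]]) (auto simp: nonneg)
  fix r :: real assume "1 < r"
  \<comment> \<open>The first bound yields
    \<open>- ln (a * \<epsilon>) \<le> r * (- ln \<epsilon>)\<close>; the second makes both
    logarithms negative.\<close>
  define M where "M = min (ln a / (r - 1)) (- 1 - \<bar>ln a\<bar>)"
  have "\<forall>\<^sub>F \<epsilon> in at_right (0::real). 0 < \<epsilon> \<and> ln \<epsilon> \<le> M"
    using eventually_conj[OF small[of 1] filterlim_at_bot[THEN iffD1, OF ln_at_0, rule_format, of M]]
    by (auto elim: eventually_mono)
  then have "?X \<le> Limsup (at_right 0) (\<lambda>\<epsilon>. ereal r * (F (a * \<epsilon>) / ereal (- ln (a * \<epsilon>))))"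
  proof (intro Limsup_mono, elim eventually_mono conjE)
    fix \<epsilon> :: real assume "0 < \<epsilon>" and M: "ln \<epsilon> \<le> M"
    have ln: "ln (a * \<epsilon>) = ln a + ln \<epsilon>" using \<open>0 < a\<close> \<open>0 < \<epsilon>\<close> by (simp add: ln_mult)
    have neg: "ln \<epsilon> < 0" "ln (a * \<epsilon>) < 0" using M unfolding ln M_def by linarith+
    have "ln \<epsilon> \<le> ln a / (r - 1)" using M unfolding M_def by linarith
    then have "ln \<epsilon> * (r - 1) \<le> ln a" using \<open>1 < r\<close> by (simp add: field_simps)
    then have le: "- ln (a * \<epsilon>) / r \<le> - ln \<epsilon>"
      using \<open>1 < r\<close> unfolding ln by (simp add: field_simps)
    have "F (a * \<epsilon>) / ereal (- ln \<epsilon>) \<le> F (a * \<epsilon>) / ereal (- ln (a * \<epsilon>) / r)"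
      using neg le \<open>0 < a\<close> \<open>0 < \<epsilon>\<close> \<open>1 < r\<close>
      by (intro ereal_divide_right_antimono_pos nonneg) (auto simp: field_simps)
    also have "\<dots> = ereal r * (F (a * \<epsilon>) / ereal (- ln (a * \<epsilon>)))"
      using neg \<open>1 < r\<close> by (cases "F (a * \<epsilon>)") (auto simp: field_simps)
    finally show "F (a * \<epsilon>) / ereal (- ln \<epsilon>) \<le> \<dots>" .
  qed
  also have "\<dots> = ereal r * Limsup (at_right 0) (\<lambda>\<epsilon>. F (a * \<epsilon>) / ereal (- ln (a * \<epsilon>)))"
    using \<open>1 < r\<close> by (intro Limsup_ereal_mult_left) auto
  \<comment> \<open>Multiplication by \<open>a\<close> maps the filter \<open>at_right 0\<close>
    onto itself, so the scaling can be substituted away.\<close>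
  also have "Limsup (at_right 0) (\<lambda>\<epsilon>. F (a * \<epsilon>) / ereal (- ln (a * \<epsilon>)))
      = Limsup (filtermap ((*) a) (at_right 0)) (\<lambda>\<epsilon>. F \<epsilon> / ereal (- ln \<epsilon>))"
    using \<open>0 < a\<close> by (intro Limsup_filtermap_eq[symmetric]) (simp add: inj_on_def)
  also have "\<dots> = ?L"
    using filtermap_times_pos_at_right[OF \<open>0 < a\<close>, of 0] by simp
  finally show "?X \<le> ereal r * ?L" .
qed

text \<open>The logarithmic form of a packing bound. For \<open>v = 0\<close> the right side is
  infinite; an infinite \<open>v\<close> contradicts \<open>le\<close>, since \<open>k\<close> is
  positive.\<close>

lemma ln_le_minus_elog:
  assumes le: "ennreal (real k) * v \<le> ennreal c" and "1 \<le> k" "0 < c" "1 \<le> n"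
  shows "ereal (1 / real n * ln (real k)) \<le> ereal (ln c / real n) + - (ereal (1 / real n) * elog v)"
proof (cases v)
  case (real r)
  show ?thesis
  proof (cases "r = 0")
    case False
    have "real k * r \<le> c"
      using le real assms by (simp add: ennreal_mult[symmetric])
    then have "ln (real k * r) \<le> ln c"
      using assms False real by (subst ln_le_cancel_iff) auto
    then have "ln (real k) \<le> ln c - ln r"
      using assms False real by (simp add: ln_mult)
    from divide_right_mono[OF this, of "real n"] show ?thesis
      using assms False real by (simp add: elog_def diff_divide_distrib)
  qed (use real assms in \<open>simp add: elog_def\<close>)
next
  case top
  then show ?thesis using assms by (simp add: ennreal_mult_top top_unique)
qed

text \<open>The logarithmic form of a covering bound. Here \<open>v = 0\<close> contradicts
  \<open>ge\<close>, and an infinite \<open>v\<close> makes the left side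
  \<open>- \<infinity>\<close>.\<close>

lemma minus_elog_le_ln:
  assumes ge: "1 \<le> ennreal c * ennreal (real k) * v" and "1 \<le> k" "0 < c" "1 \<le> n"
  shows "- (ereal (1 / real n) * elog v) \<le> ereal (ln c / real n) + ereal (1 / real n * ln (real k))"
proof (cases v)
  case (real r)
  have "1 \<le> c * real k * r"
    using ge real assms by (simp add: ennreal_mult[symmetric] flip: ennreal_1)
  then have r: "0 < r" using assms real by (metis less_le mult_zero_right not_one_le_zero)
  have "ln 1 \<le> ln (c * real k * r)"
    using assms r \<open>1 \<le> c * real k * r\<close> by (subst ln_le_cancel_iff) auto
  then have "- ln r \<le> ln c + ln (real k)"
    using assms r by (simp add: ln_mult)
  from divide_right_mono[OF this, of "real n"] show ?thesis
    using assms r real by (simp add: elog_def add_divide_distrib)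
next
  case top
  then show ?thesis using assms by (simp add: elog_def)
qed

lemma less_minus_elogD:
  assumes "ereal r < - (ereal (1 / real n) * elog v)" and "1 \<le> n"
  shows "v \<le> ennreal (exp (- (real n * r)))"
proof (cases v)
  case (real u)
  show ?thesis
  proof (cases "u = 0")
    case False
    then have "ln u < - (real n * r)"
      using assms real by (simp add: elog_def field_simps)
    then have "u \<le> exp (- (real n * r))"
      using False real by (metis exp_ln exp_less_cancel_iff less_le)
    then show ?thesis using real by (simp add: ennreal_leI)
  qed (use real in simp)
next
  case top
  then show ?thesis using assms by (simp add: elog_def)
qed

text \<open>This removes the homogeneity constant \<open>c\<close>: being independent of
  \<open>n\<close>, it enters only through \<open>ln c / n\<close>.\<close>

lemma limsup_vanishing_add:
  fixes v :: "nat \<Rightarrow> ereal"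
  shows "limsup (\<lambda>n. ereal (C / real n) + v n) = limsup v"
proof -
  have "(\<lambda>n. ereal (C / real n)) \<longlonglongrightarrow> ereal 0"
    by (intro tendsto_ereal lim_const_over_n)
  then show ?thesis by (subst ereal_limsup_lim_add[where a = 0]) (auto simp: zero_ereal_def)
qed

section \<open>Separated sets and dynamical balls\<close>

lemma dyn_ball_commute: "y \<in> dyn_ball S n x \<epsilon> \<longleftrightarrow> x \<in> dyn_ball S n y \<epsilon>"
  by (simp add: dyn_ball_def dist_commute)

lemma dyn_ball_mono: "\<epsilon> \<le> \<epsilon>' \<Longrightarrow> dyn_ball S n x \<epsilon> \<subseteq> dyn_ball S n x \<epsilon>'"
  by (force simp: dyn_ball_def)

lemma dyn_ball_self: "0 < \<epsilon> \<Longrightarrow> x \<in> dyn_ball S n x \<epsilon>"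
  by (simp add: dyn_ball_def)

lemma separated_by_antimono: "separated_by S n \<epsilon>' E \<Longrightarrow> \<epsilon> \<le> \<epsilon>' \<Longrightarrow> separated_by S n \<epsilon> E"
  unfolding separated_by_def by (meson le_less_trans)

text \<open>By the triangle inequality, a common point would keep the images of both centres less
  than \<epsilon> apart under every composition of length at most \<open>n\<close>.\<close>

lemma separated_dyn_balls_disjoint:
  assumes "separated_by S n \<epsilon> E" "x \<in> E" "y \<in> E" "x \<noteq> y"
  shows "dyn_ball S n x (\<epsilon> / 2) \<inter> dyn_ball S n y (\<epsilon> / 2) = {}"
proof -
  obtain j h where "j \<le> n" "h \<in> compositions S j" "dist (h x) (h y) > \<epsilon>"
    using assms unfolding separated_by_def by blast
  then have "z \<notin> dyn_ball S n x (\<epsilon> / 2) \<or> z \<notin> dyn_ball S n y (\<epsilon> / 2)" for z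
    unfolding dyn_ball_def using dist_triangle_half_l[of "h x" "h z" \<epsilon> "h y"] by force
  then show ?thesis by blast
qed

lemma elog_mono: "u \<le> v \<Longrightarrow> elog u \<le> elog v"
  unfolding elog_def
  by (cases u; cases v) (auto simp: top_unique ennreal_le_iff)

section \<open>Compactness, maximal separated sets and coverings\<close>

locale compact_semigroup_action =
  fixes S :: "('a::metric_space \<Rightarrow> 'a) set"
  assumes compact_space: "compact (UNIV :: 'a set)"
    and finite_generators: "finite S"
    and continuous_generators: "\<And>f. f \<in> S \<Longrightarrow> continuous_on UNIV f"
begin

lemma finite_compositions: "finite (compositions S n)"
proof (induction n)
  case (Suc n)
  have "compositions S (Suc n) = (\<lambda>(f, h). f \<circ> h) ` (S \<times> compositions S n)"
    by auto
  then show ?case using Suc finite_generators by simp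
qed simp

lemma continuous_compositions: "f \<in> compositions S n \<Longrightarrow> continuous_on UNIV f"
proof (induction n arbitrary: f)
  case (Suc n)
  then obtain f' h where "f = f' \<circ> h" "f' \<in> S" "h \<in> compositions S n" by auto
  then show ?case
    using Suc.IH[of h] continuous_generators[of f']
    by (metis continuous_on_compose continuous_on_subset top_greatest)
qed (simp add: continuous_on_id)

text \<open>There are finitely many compositions of length at most \<open>n\<close>, so finitely
  many continuous conditions are intersected. Openness gives both finite subcovers and Borel
  measurability.\<close>

lemma open_dyn_ball: "open (dyn_ball S n x \<epsilon>)"
proof -
  have "dyn_ball S n x \<epsilon> = (\<Inter>j\<in>{..n}. \<Inter>h\<in>compositions S j. {y. dist (h x) (h y) < \<epsilon>})"
    by (auto simp: dyn_ball_def)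
  moreover have "open {y. dist (h x) (h y) < \<epsilon>}" if "h \<in> compositions S j" for h j
    by (intro open_Collect_less continuous_intros continuous_compositions[OF that])
  ultimately show ?thesis
    by (simp add: open_INT finite_compositions)
qed

text \<open>Finitely many balls of radius \<open>\<epsilon> / 2\<close> cover the space. By symmetry
  each point of \<open>E\<close> has one of their centres in its own ball, and these balls are
  disjoint, so different points get different centres.\<close>

lemma card_separated_bounded:
  assumes "0 < \<epsilon>"
  obtains N where "\<And>E. finite E \<Longrightarrow> separated_by S n \<epsilon> E \<Longrightarrow> card E \<le> N"
proof -
  have "UNIV \<subseteq> (\<Union>x. dyn_ball S n x (\<epsilon> / 2))"
    using assms by (auto intro!: dyn_ball_self)
  then obtain C where C: "finite C" "UNIV \<subseteq> (\<Union>x\<in>C. dyn_ball S n x (\<epsilon> / 2))"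
    using compactE_image[OF compact_space, of UNIV "\<lambda>x. dyn_ball S n x (\<epsilon> / 2)"] open_dyn_ball
    by metis
  have "card E \<le> card C" if E: "finite E" "separated_by S n \<epsilon> E" for E
  proof -
    have "\<forall>y. \<exists>x\<in>C. x \<in> dyn_ball S n y (\<epsilon> / 2)"
      using C(2) dyn_ball_commute by fast
    then obtain f where f: "\<And>y. f y \<in> C" "\<And>y. f y \<in> dyn_ball S n y (\<epsilon> / 2)"
      by metis
    have "inj_on f E"
      using separated_dyn_balls_disjoint[OF E(2)] f(2) by (intro inj_onI) (metis disjoint_iff)
    then show ?thesis using f(1) C(1) by (intro card_inj_on_le) auto
  qed
  then show ?thesis using that by blast
qed

lemma max_separated_attained:
  assumes "0 < \<epsilon>"
  obtains E where "finite E" "separated_by S n \<epsilon> E" "card E = max_separated S n \<epsilon>"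
proof -
  let ?X = "{card E | E. finite E \<and> separated_by S n \<epsilon> E}"
  obtain N where "\<And>E. finite E \<Longrightarrow> separated_by S n \<epsilon> E \<Longrightarrow> card E \<le> N"
    using card_separated_bounded[OF assms, of n] by metis
  then have "?X \<subseteq> {..N}" by blast
  then have "finite ?X" using finite_subset by blast
  \<comment> \<open>Nonemptiness of \<open>?X\<close> makes its supremum a genuine
    \<open>Max\<close> rather than the default value.\<close>
  moreover have "card {} \<in> ?X" by (intro CollectI exI[of _ "{}"]) (simp add: separated_by_def)
  ultimately have "max_separated S n \<epsilon> \<in> ?X"
    unfolding max_separated_def Sup_nat_def using Max_in[of ?X] by (metis (no_types, lifting) empty_iff)
  then show ?thesis using that by auto
qed

lemma card_le_max_separated:
  assumes "0 < \<epsilon>" "finite E" "separated_by S n \<epsilon> E"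
  shows "card E \<le> max_separated S n \<epsilon>"
proof -
  obtain N where "\<And>E. finite E \<Longrightarrow> separated_by S n \<epsilon> E \<Longrightarrow> card E \<le> N"
    using card_separated_bounded[OF assms(1), of n] by metis
  then show ?thesis
    unfolding max_separated_def using assms
    by (intro cSup_upper bdd_aboveI[of _ N]) auto
qed

text \<open>A singleton is vacuously separated, and \<open>undefined\<close> is a point of the type.
  Thus the logarithm of the count is never taken at 0.\<close>

lemma max_separated_ge_1: "0 < \<epsilon> \<Longrightarrow> 1 \<le> max_separated S n \<epsilon>"
  using card_le_max_separated[of \<epsilon> "{undefined}" n] by (simp add: separated_by_def)

lemma max_separated_antimono:
  assumes "0 < \<epsilon>" "\<epsilon> \<le> \<epsilon>'"
  shows "max_separated S n \<epsilon>' \<le> max_separated S n \<epsilon>"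
proof -
  obtain E where "finite E" "separated_by S n \<epsilon>' E" "card E = max_separated S n \<epsilon>'"
    using max_separated_attained[of \<epsilon>' n] assms by auto
  then show ?thesis
    using card_le_max_separated[of \<epsilon> E n] separated_by_antimono assms by metis
qed

text \<open>A separated subset of \<open>A\<close> of largest cardinality covers \<open>A\<close>,
  as an uncovered point could be added. The gap \<open>\<epsilon> < \<epsilon>'\<close> is there
  because lying outside an open ball gives only distance at least \<open>\<epsilon>'\<close>, while
  separation is strict. Taking the centres in \<open>A\<close> lets bounds known on \<open>A\<close>
  apply to their balls.\<close>

lemma separated_cover:
  assumes "0 < \<epsilon>" "\<epsilon> < \<epsilon>'"
  obtains E where "E \<subseteq> A" "finite E" "card E \<le> max_separated S n \<epsilon>"
    "A \<subseteq> (\<Union>x\<in>E. dyn_ball S n x \<epsilon>')"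
proof -
  let ?P = "\<lambda>E. E \<subseteq> A \<and> finite E \<and> separated_by S n \<epsilon> E"
  obtain N where N: "\<And>E. finite E \<Longrightarrow> separated_by S n \<epsilon> E \<Longrightarrow> card E \<le> N"
    using card_separated_bounded[OF assms(1), of n] by metis
  have "?P {}" by (simp add: separated_by_def)
  moreover have "\<forall>E. ?P E \<longrightarrow> card E < Suc N" using N by (auto simp: less_Suc_eq_le)
  ultimately obtain E where E: "?P E" and max: "\<And>E'. ?P E' \<Longrightarrow> card E' \<le> card E"
    using ex_has_greatest_nat[of ?P "{}" card "Suc N"] by blast
  have "A \<subseteq> (\<Union>x\<in>E. dyn_ball S n x \<epsilon>')"
  proof (rule ccontr)
    assume "\<not> ?thesis"
    then obtain y where y: "y \<in> A" "\<And>x. x \<in> E \<Longrightarrow> y \<notin> dyn_ball S n x \<epsilon>'" by blast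
    have "y \<notin> E" using y(2) dyn_ball_self[of \<epsilon>' y S n] assms by auto
    have sep: "\<exists>j\<le>n. \<exists>h\<in>compositions S j. dist (h x) (h y) > \<epsilon>" if "x \<in> E" for x
      using y(2)[OF that] assms(2) unfolding dyn_ball_def by force
    have "?P (insert y E)"
      using E y(1) sep unfolding separated_by_def by (simp add: dist_commute)
    from max[OF this] show False using E \<open>y \<notin> E\<close> by simp
  qed
  then show ?thesis using that E card_le_max_separated[OF assms(1)] by blast
qed

lemma entropy_GLW_nonneg: "0 < \<epsilon> \<Longrightarrow> 0 \<le> entropy_GLW S \<epsilon>"
  unfolding entropy_GLW_def
  using max_separated_ge_1[of \<epsilon>] by (intro le_Limsup always_eventually allI) auto

lemma entropy_GLW_antimono:
  assumes "0 < \<epsilon>" "\<epsilon> \<le> \<epsilon>'"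
  shows "entropy_GLW S \<epsilon>' \<le> entropy_GLW S \<epsilon>"
  unfolding entropy_GLW_def
proof (intro Limsup_mono always_eventually allI)
  fix n
  have "ln (real (max_separated S n \<epsilon>')) \<le> ln (real (max_separated S n \<epsilon>))"
    using max_separated_antimono[OF assms, of n] max_separated_ge_1[of \<epsilon>' n] assms
    by (subst ln_le_cancel_iff) auto
  then show "ereal (1 / real n * ln (real (max_separated S n \<epsilon>')))
             \<le> ereal (1 / real n * ln (real (max_separated S n \<epsilon>)))"
    by (simp add: divide_right_mono)
qed

end

section \<open>Measurability of dynamical balls, monotonicity and sign of local entropies\<close>

locale measured_semigroup_action = compact_semigroup_action S
  for S :: "('a::metric_space \<Rightarrow> 'a) set" +
  fixes \<nu> :: "'a measure"
  assumes sets_eq_borel: "sets \<nu> = sets borel"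
begin

lemma dyn_ball_measurable [measurable]: "dyn_ball S n x \<epsilon> \<in> sets \<nu>"
  unfolding sets_eq_borel using open_dyn_ball by simp

lemma space_eq_UNIV: "space \<nu> = UNIV"
  using sets_eq_imp_space_eq[OF sets_eq_borel] by simp

lemma local_entropy_summand_antimono:
  assumes "\<epsilon> \<le> \<epsilon>'"
  shows "- (ereal (1 / real n) * elog (emeasure \<nu> (dyn_ball S n x \<epsilon>')))
         \<le> - (ereal (1 / real n) * elog (emeasure \<nu> (dyn_ball S n x \<epsilon>)))"
  using assms
  by (simp, intro ereal_mult_left_mono elog_mono emeasure_mono dyn_ball_mono) auto

lemma upper_local_entropy_antimono:
  "\<epsilon> \<le> \<epsilon>' \<Longrightarrow> upper_local_entropy S \<nu> x \<epsilon>' \<le> upper_local_entropy S \<nu> x \<epsilon>"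
  unfolding upper_local_entropy_def
  by (intro Limsup_mono always_eventually allI local_entropy_summand_antimono)

lemma lower_local_entropy_antimono:
  "\<epsilon> \<le> \<epsilon>' \<Longrightarrow> lower_local_entropy S \<nu> x \<epsilon>' \<le> lower_local_entropy S \<nu> x \<epsilon>"
  unfolding lower_local_entropy_def
  by (intro Liminf_mono always_eventually allI local_entropy_summand_antimono)

lemma upper_local_entropy_nonneg:
  assumes "prob_space \<nu>"
  shows "0 \<le> upper_local_entropy S \<nu> x \<epsilon>"
  unfolding upper_local_entropy_def
proof (intro le_Limsup always_eventually allI)
  fix n
  have "elog (emeasure \<nu> (dyn_ball S n x \<epsilon>)) \<le> elog 1"
    using prob_space.emeasure_le_1[OF assms] by (intro elog_mono)
  also have "elog 1 = 0" by (simp add: elog_def)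
  finally have "elog (emeasure \<nu> (dyn_ball S n x \<epsilon>)) \<le> 0" .
  then show "0 \<le> - (ereal (1 / real n) * elog (emeasure \<nu> (dyn_ball S n x \<epsilon>)))"
    using ereal_mult_left_mono[of _ 0 "ereal (1 / real n)"] by simp
qed simp

section \<open>Homogeneous measures\<close>

text \<open>Packing: the balls of radius \<open>\<epsilon> / 2\<close> around a largest separated
  set are disjoint, and each has at least \<open>1 / c\<close> times the mass of the ball around
  \<open>x\<close>. As the total mass is 1, the count times that mass is at most
  \<open>c\<close>.\<close>

lemma entropy_GLW_le_upper_local_entropy:
  assumes "prob_space \<nu>" "homogeneous_with S \<nu> \<delta>" "0 < \<epsilon>"
  shows "entropy_GLW S \<epsilon> \<le> upper_local_entropy S \<nu> x (\<delta> (\<epsilon> / 2))"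
proof -
  obtain c where c: "0 < c" and le: "\<And>n x y. emeasure \<nu> (dyn_ball S n x (\<delta> (\<epsilon> / 2)))
      \<le> ennreal c * emeasure \<nu> (dyn_ball S n y (\<epsilon> / 2))"
    using assms unfolding homogeneous_with_def by (meson half_gt_zero)
  have bound: "ennreal (real (max_separated S n \<epsilon>)) * emeasure \<nu> (dyn_ball S n x (\<delta> (\<epsilon> / 2)))
      \<le> ennreal c" for n
  proof -
    obtain E where E: "finite E" "separated_by S n \<epsilon> E" "card E = max_separated S n \<epsilon>"
      using max_separated_attained[OF assms(3)] .
    have disj: "disjoint_family_on (\<lambda>y. dyn_ball S n y (\<epsilon> / 2)) E"
      using separated_dyn_balls_disjoint[OF E(2)] unfolding disjoint_family_on_def by blast
    have "ennreal (real (card E)) * emeasure \<nu> (dyn_ball S n x (\<delta> (\<epsilon> / 2)))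
        = (\<Sum>y\<in>E. emeasure \<nu> (dyn_ball S n x (\<delta> (\<epsilon> / 2))))"
      by (simp add: ennreal_of_nat_eq_real_of_nat)
    also have "\<dots> \<le> (\<Sum>y\<in>E. ennreal c * emeasure \<nu> (dyn_ball S n y (\<epsilon> / 2)))"
      by (intro sum_mono le)
    also have "\<dots> = ennreal c * emeasure \<nu> (\<Union>y\<in>E. dyn_ball S n y (\<epsilon> / 2))"
      using E(1) disj by (subst sum_emeasure[symmetric]) (auto simp: sum_distrib_left)
    also have "\<dots> \<le> ennreal c * 1"
      by (intro mult_left_mono prob_space.emeasure_le_1[OF assms(1)]) auto
    finally show ?thesis using E(3) by simp
  qed
  have "entropy_GLW S \<epsilon> \<le> limsup (\<lambda>n. ereal (ln c / real n) +
      - (ereal (1 / real n) * elog (emeasure \<nu> (dyn_ball S n x (\<delta> (\<epsilon> / 2))))))"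
    unfolding entropy_GLW_def
    using max_separated_ge_1[OF assms(3)] c
    by (intro Limsup_mono eventually_mono[OF eventually_ge_at_top[of 1]] ln_le_minus_elog[OF bound])
       auto
  then show ?thesis by (simp add: limsup_vanishing_add upper_local_entropy_def)
qed

text \<open>Covering: the balls of radius \<open>\<delta> \<epsilon>\<close> around a maximal
  \<open>\<delta> \<epsilon> / 2\<close>-separated set have total mass at least 1, and each has at
  most \<open>c\<close> times the mass of the ball around \<open>x\<close>. The halving provides the
  gap required by \<open>separated_cover\<close>.\<close>

lemma upper_local_entropy_le_entropy_GLW:
  assumes "prob_space \<nu>" "homogeneous_with S \<nu> \<delta>" "0 < \<epsilon>"
  shows "upper_local_entropy S \<nu> x \<epsilon> \<le> entropy_GLW S (\<delta> \<epsilon> / 2)"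
proof -
  have pos: "0 < \<delta> \<epsilon> / 2" using assms unfolding homogeneous_with_def by simp
  obtain c where c: "0 < c" and le: "\<And>n x y. emeasure \<nu> (dyn_ball S n x (\<delta> \<epsilon>))
      \<le> ennreal c * emeasure \<nu> (dyn_ball S n y \<epsilon>)"
    using assms unfolding homogeneous_with_def by meson
  have bound: "1 \<le> ennreal c * ennreal (real (max_separated S n (\<delta> \<epsilon> / 2)))
      * emeasure \<nu> (dyn_ball S n x \<epsilon>)" for n
  proof -
    obtain E where E: "finite E" "card E \<le> max_separated S n (\<delta> \<epsilon> / 2)"
        "UNIV \<subseteq> (\<Union>y\<in>E. dyn_ball S n y (\<delta> \<epsilon>))"
      using separated_cover[OF pos, of "\<delta> \<epsilon>" UNIV n] pos by auto
    have "1 = emeasure \<nu> UNIV"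
      using prob_space.emeasure_space_1[OF assms(1)] by (simp add: space_eq_UNIV)
    also have "\<dots> \<le> emeasure \<nu> (\<Union>y\<in>E. dyn_ball S n y (\<delta> \<epsilon>))"
      using E by (intro emeasure_mono) auto
    also have "\<dots> \<le> (\<Sum>y\<in>E. emeasure \<nu> (dyn_ball S n y (\<delta> \<epsilon>)))"
      using E(1) by (intro emeasure_subadditive_finite) auto
    also have "\<dots> \<le> (\<Sum>y\<in>E. ennreal c * emeasure \<nu> (dyn_ball S n x \<epsilon>))"
      by (intro sum_mono le)
    also have "\<dots> = ennreal (real (card E)) * (ennreal c * emeasure \<nu> (dyn_ball S n x \<epsilon>))"
      by (simp add: ennreal_of_nat_eq_real_of_nat)
    also have "\<dots> \<le> ennreal (real (max_separated S n (\<delta> \<epsilon> / 2)))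
        * (ennreal c * emeasure \<nu> (dyn_ball S n x \<epsilon>))"
      using E(2) by (intro mult_right_mono ennreal_leI) auto
    finally show ?thesis by (simp add: ac_simps)
  qed
  have "upper_local_entropy S \<nu> x \<epsilon> \<le> limsup (\<lambda>n. ereal (ln c / real n) +
      ereal (1 / real n * ln (real (max_separated S n (\<delta> \<epsilon> / 2)))))"
    unfolding upper_local_entropy_def
    using max_separated_ge_1[OF pos] c
    by (intro Limsup_mono eventually_mono[OF eventually_ge_at_top[of 1]] minus_elog_le_ln[OF bound])
       auto
  then show ?thesis by (simp only: limsup_vanishing_add entropy_GLW_def)
qed

lemma upper_mdim_GLW_eq_if_strongly_homogeneous:
  assumes prob: "prob_space \<nu>" and "strongly_homogeneous S \<nu>"
  shows "upper_mdim_GLW S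
    = Limsup (at_right 0) (\<lambda>\<epsilon>. upper_local_entropy S \<nu> x \<epsilon> / ereal (- ln \<epsilon>))"
proof -
  obtain \<delta> where hom: "homogeneous_with S \<nu> \<delta>" and \<delta>: "\<delta> \<in> \<Theta>[at_right 0](\<lambda>\<epsilon>. \<epsilon>)"
    using assms(2) unfolding strongly_homogeneous_def by blast
  have \<delta>_pos: "0 < \<delta> \<epsilon>" if "0 < \<epsilon>" for \<epsilon>
    using hom that unfolding homogeneous_with_def by simp
  \<comment> \<open>The lower estimate contained in \<open>\<Theta>\<close> gives a linear bound for
    \<delta> from below, so passing from \<epsilon> to \<open>\<delta> \<epsilon>\<close> shrinks
    the radius by a bounded factor.\<close>
  obtain a where a: "0 < a" and "\<forall>\<^sub>F \<epsilon> in at_right 0. a * norm \<epsilon> \<le> norm (\<delta> \<epsilon>)"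
    using bigthetaD2[OF \<delta>] by (elim landau_omega.bigE) auto
  then obtain b where b: "0 < b" and "\<forall>\<epsilon>>0. \<epsilon> < b \<longrightarrow> a * norm \<epsilon> \<le> norm (\<delta> \<epsilon>)"
    unfolding eventually_at_right_field by auto
  then have ge: "a * \<epsilon> \<le> \<delta> \<epsilon>" if "0 < \<epsilon>" "\<epsilon> < b" for \<epsilon>
    using that \<delta>_pos[OF that(1)] by force
  \<comment> \<open>Below \<open>b\<close> the linear bound holds; below 1 the divisor
    \<open>- ln \<epsilon>\<close> is positive.\<close>
  have small: "\<forall>\<^sub>F \<epsilon> in at_right (0::real). 0 < \<epsilon> \<and> \<epsilon> < min 1 b"
    using eventually_at_right_real[of 0 "min 1 b"] b by simp
  show ?thesis
  proof (rule antisym)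
    have "upper_mdim_GLW S
        \<le> Limsup (at_right 0) (\<lambda>\<epsilon>. upper_local_entropy S \<nu> x (a / 2 * \<epsilon>) / ereal (- ln \<epsilon>))"
      unfolding upper_mdim_GLW_def
    proof (intro Limsup_mono eventually_mono[OF small] ereal_divide_right_mono)
      fix \<epsilon> :: real assume \<epsilon>: "0 < \<epsilon> \<and> \<epsilon> < min 1 b"
      have "entropy_GLW S \<epsilon> \<le> upper_local_entropy S \<nu> x (\<delta> (\<epsilon> / 2))"
        using entropy_GLW_le_upper_local_entropy[OF prob hom] \<epsilon> by simp
      also have "\<dots> \<le> upper_local_entropy S \<nu> x (a / 2 * \<epsilon>)"
        using ge[of "\<epsilon> / 2"] \<epsilon> by (intro upper_local_entropy_antimono) auto
      finally show "entropy_GLW S \<epsilon> \<le> \<dots>" .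
    qed auto
    also have "\<dots> \<le> Limsup (at_right 0) (\<lambda>\<epsilon>. upper_local_entropy S \<nu> x \<epsilon> / ereal (- ln \<epsilon>))"
      using a by (intro Limsup_rescale_div_ln_le upper_local_entropy_nonneg prob) auto
    finally show "upper_mdim_GLW S \<le> \<dots>" .
  next
    have "Limsup (at_right 0) (\<lambda>\<epsilon>. upper_local_entropy S \<nu> x \<epsilon> / ereal (- ln \<epsilon>))
        \<le> Limsup (at_right 0) (\<lambda>\<epsilon>. entropy_GLW S (a / 2 * \<epsilon>) / ereal (- ln \<epsilon>))"
    proof (intro Limsup_mono eventually_mono[OF small] ereal_divide_right_mono)
      fix \<epsilon> :: real assume \<epsilon>: "0 < \<epsilon> \<and> \<epsilon> < min 1 b"
      have "upper_local_entropy S \<nu> x \<epsilon> \<le> entropy_GLW S (\<delta> \<epsilon> / 2)"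
        using upper_local_entropy_le_entropy_GLW[OF prob hom] \<epsilon> by simp
      also have "\<dots> \<le> entropy_GLW S (a / 2 * \<epsilon>)"
        using ge[of \<epsilon>] \<epsilon> a by (intro entropy_GLW_antimono) auto
      finally show "upper_local_entropy S \<nu> x \<epsilon> \<le> \<dots>" .
    qed auto
    also have "\<dots> \<le> upper_mdim_GLW S"
      unfolding upper_mdim_GLW_def using a by (intro Limsup_rescale_div_ln_le entropy_GLW_nonneg) auto
    finally show "Limsup (at_right 0) (\<lambda>\<epsilon>. upper_local_entropy S \<nu> x \<epsilon> / ereal (- ln \<epsilon>))
        \<le> upper_mdim_GLW S" .
  qed
qed

section \<open>The lower bound by local entropies\<close>

text \<open>At most about \<open>exp (n * q)\<close> balls of measure at most
  \<open>exp (- n * r)\<close>, with \<open>q < r\<close>, cover the points whose balls are small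
  from a fixed time on. The conclusion speaks of a null superset \<open>G\<close>, so measurability
  of the set of points itself is never at issue.\<close>

lemma large_local_entropy_null:
  assumes "0 < \<epsilon>" and "entropy_GLW S (\<epsilon> / 2) < ereal r"
  shows "\<exists>G\<in>null_sets \<nu>. {x. ereal r < lower_local_entropy S \<nu> x \<epsilon>} \<subseteq> G"
proof -
  obtain q where q: "entropy_GLW S (\<epsilon> / 2) < ereal q" "q < r"
    using ereal_dense2[OF assms(2)] by auto
  have "\<forall>\<^sub>F n in sequentially. ereal (1 / real n * ln (real (max_separated S n (\<epsilon> / 2)))) < ereal q"
    using q(1) unfolding entropy_GLW_def by (rule Limsup_lessD)
  then obtain M where M: "\<And>n. n \<ge> M \<Longrightarrow> 1 / real n * ln (real (max_separated S n (\<epsilon> / 2))) < q"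
    unfolding eventually_sequentially by auto
  have card: "real (max_separated S n (\<epsilon> / 2)) \<le> exp (real n * q)" if "n \<ge> M" "n \<ge> 1" for n
  proof -
    have "ln (real (max_separated S n (\<epsilon> / 2))) \<le> real n * q"
      using M[OF that(1)] that(2) by (simp add: field_simps)
    then show ?thesis
      using max_separated_ge_1[of "\<epsilon> / 2" n] assms(1)
      by (metis exp_le_cancel_iff exp_ln half_gt_zero not_one_le_zero of_nat_0_less_iff zero_less_iff_neq_zero)
  qed
  \<comment> \<open>Fixing the time \<open>N\<close> from which the decay holds makes the estimate
    uniform over the points; the sets \<open>A N\<close> exhaust the points in question.\<close>
  define A where "A N = {x. \<forall>n\<ge>N. emeasure \<nu> (dyn_ball S n x \<epsilon>) \<le> ennreal (exp (- (real n * r)))}" for N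
  have "\<exists>G\<in>null_sets \<nu>. A N \<subseteq> G" for N
  proof -
    \<comment> \<open>From \<open>L\<close> on, the decay in \<open>A N\<close> and the count bound
      from \<open>M\<close> both hold, and \<open>n\<close> is positive.\<close>
    define L where "L = N + M + 1"
    have "\<exists>U\<in>sets \<nu>. A N \<subseteq> U \<and> emeasure \<nu> U \<le> ennreal (exp (- (real n * (r - q))))" if "n \<ge> L" for n
    proof -
      obtain E where E: "E \<subseteq> A N" "finite E" "card E \<le> max_separated S n (\<epsilon> / 2)"
          "A N \<subseteq> (\<Union>x\<in>E. dyn_ball S n x \<epsilon>)"
        using separated_cover[of "\<epsilon> / 2" \<epsilon> "A N" n] assms(1) by auto
      have "emeasure \<nu> (\<Union>x\<in>E. dyn_ball S n x \<epsilon>) \<le> (\<Sum>x\<in>E. emeasure \<nu> (dyn_ball S n x \<epsilon>))"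
        using E(2) by (intro emeasure_subadditive_finite) auto
      also have "\<dots> \<le> (\<Sum>x\<in>E. ennreal (exp (- (real n * r))))"
        using E(1) that by (intro sum_mono) (auto simp: A_def L_def)
      also have "\<dots> = ennreal (real (card E) * exp (- (real n * r)))"
        by (simp add: ennreal_of_nat_eq_real_of_nat ennreal_mult)
      also have "\<dots> \<le> ennreal (exp (real n * q) * exp (- (real n * r)))"
        using E(3) card[of n] that by (intro ennreal_leI mult_right_mono) (auto simp: L_def)
      also have "exp (real n * q) * exp (- (real n * r)) = exp (- (real n * (r - q)))"
        by (simp add: exp_add[symmetric] algebra_simps)
      finally show ?thesis using E(4) by (intro bexI[of _ "\<Union>x\<in>E. dyn_ball S n x \<epsilon>"]) (use E(2) in auto)
    qed
    then obtain U where U: "\<And>n. n \<ge> L \<Longrightarrow> U n \<in> sets \<nu>" "\<And>n. n \<ge> L \<Longrightarrow> A N \<subseteq> U n"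
        "\<And>n. n \<ge> L \<Longrightarrow> emeasure \<nu> (U n) \<le> ennreal (exp (- (real n * (r - q))))"
      by metis
    \<comment> \<open>The covers for different \<open>n\<close> need not be nested. Their
      intersection still contains \<open>A N\<close>, and its measure lies below every one of the
      bounds, which tend to 0.\<close>
    have sets: "(\<Inter>n\<in>{L..}. U n) \<in> sets \<nu>" using U(1) by (intro sets.countable_INT') auto
    have "(\<lambda>n. ennreal (exp (- (real n * (r - q))))) \<longlonglongrightarrow> ennreal 0"
      using q(2) by (intro tendsto_ennrealI) real_asymp
    moreover have "emeasure \<nu> (\<Inter>n\<in>{L..}. U n) \<le> ennreal (exp (- (real n * (r - q))))" if "n \<ge> L" for n
    proof -
      have "emeasure \<nu> (\<Inter>n\<in>{L..}. U n) \<le> emeasure \<nu> (U n)"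
        using U(1) that by (intro emeasure_mono INT_lower) auto
      also note U(3)[OF that]
      finally show ?thesis .
    qed
    ultimately have "emeasure \<nu> (\<Inter>n\<in>{L..}. U n) \<le> ennreal 0"
      by (rule tendsto_lowerbound[OF _ eventually_sequentiallyI[of L]]) auto
    then show ?thesis using U(2) sets by (intro bexI[of _ "\<Inter>n\<in>{L..}. U n"]) auto
  qed
  then obtain G where G: "\<And>N. G N \<in> null_sets \<nu>" "\<And>N. A N \<subseteq> G N" by metis
  have "\<exists>N. x \<in> A N" if "ereal r < lower_local_entropy S \<nu> x \<epsilon>" for x
  proof -
    have "\<forall>\<^sub>F n in sequentially. ereal r < - (ereal (1 / real n) * elog (emeasure \<nu> (dyn_ball S n x \<epsilon>)))"
      using that unfolding lower_local_entropy_def by (rule less_LiminfD)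
    then obtain N where
      "\<And>n. n \<ge> N \<Longrightarrow> ereal r < - (ereal (1 / real n) * elog (emeasure \<nu> (dyn_ball S n x \<epsilon>)))"
      unfolding eventually_sequentially by auto
    \<comment> \<open>The maximum with 1 skips \<open>n = 0\<close>, where \<open>1 / real n\<close>
      is 0 and no decay can be inferred.\<close>
    then have "x \<in> A (max N 1)" using less_minus_elogD by (auto simp: A_def)
    then show ?thesis ..
  qed
  then have "{x. ereal r < lower_local_entropy S \<nu> x \<epsilon>} \<subseteq> (\<Union>N. G N)" using G(2) by blast
  moreover have "(\<Union>N. G N) \<in> null_sets \<nu>" using G(1) by (rule null_sets_UN)
  ultimately show ?thesis by blast
qed

text \<open>Rounding \<open>- ln \<epsilon>\<close> up to an integer \<open>k\<close> can only
  increase the local entropy and changes the denominator by at most 1. So the upper limit over all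
  radii is seen along \<open>exp (- k)\<close>, up to the loss from \<open>s\<close> to
  \<open>t\<close>.\<close>

lemma exp_scale_local_entropy:
  assumes "ereal s \<le> upper_local_mdim S \<nu> x" and "0 < t" "t < s"
  shows "\<exists>k\<ge>K. ereal (t * real k) < lower_local_entropy S \<nu> x (exp (- real k))"
proof (rule ccontr)
  assume "\<not> ?thesis"
  then have small: "lower_local_entropy S \<nu> x (exp (- real k)) \<le> ereal (t * real k)" if "k \<ge> K" for k
    using that by (auto simp: not_less)
  define u where "u = (t + s) / 2"
  have u: "t < u" "u < s" "0 < u" using assms unfolding u_def by auto
  \<comment> \<open>For \<open>l = - ln \<epsilon>\<close> this gives \<open>l \<ge> K\<close>,
    hence \<open>k \<ge> K\<close>; \<open>l \<ge> 1\<close>, so that division by \<open>l\<close>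
    is safe; and \<open>t * (l + 1) \<le> u * l\<close>, which absorbs the rounding.\<close>
  define M where "M = - max (real K) (max 1 (t / (u - t)))"
  have "\<forall>\<^sub>F \<epsilon> in at_right (0::real). 0 < \<epsilon> \<and> ln \<epsilon> \<le> M"
    using eventually_conj[OF eventually_at_right_real[OF zero_less_one]
        filterlim_at_bot[THEN iffD1, OF ln_at_0, rule_format, of M]]
    by (auto elim: eventually_mono)
  then have "upper_local_mdim S \<nu> x \<le> ereal u"
    unfolding upper_local_mdim_def
  proof (intro Limsup_bounded, elim eventually_mono conjE)
    fix \<epsilon> :: real assume "0 < \<epsilon>" and M: "ln \<epsilon> \<le> M"
    define l where "l = - ln \<epsilon>"
    have l: "real K \<le> l" "1 \<le> l" "t / (u - t) \<le> l" using M unfolding M_def l_def by linarith+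
    define k where "k = nat \<lceil>l\<rceil>"
    have k: "l \<le> real k" "real k \<le> l + 1" using l(2) unfolding k_def by linarith+
    then have "K \<le> k" using l(1) by linarith
    have "exp (- real k) \<le> exp (- l)" using k(1) by simp
    also have "\<dots> = \<epsilon>" using \<open>0 < \<epsilon>\<close> by (simp add: l_def)
    finally have "lower_local_entropy S \<nu> x \<epsilon> \<le> lower_local_entropy S \<nu> x (exp (- real k))"
      by (rule lower_local_entropy_antimono)
    also have "\<dots> \<le> ereal (t * real k)" by (rule small[OF \<open>K \<le> k\<close>])
    also have "t * real k \<le> t * (l + 1)" using k(2) assms(2) by simp
    also have "\<dots> \<le> u * l" using l(3) u by (simp add: field_simps)
    finally have "lower_local_entropy S \<nu> x \<epsilon> \<le> ereal (u * l)" by simp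
    then have "lower_local_entropy S \<nu> x \<epsilon> / ereal l \<le> ereal (u * l) / ereal l"
      using l(2) by (intro ereal_divide_right_mono) auto
    then show "lower_local_entropy S \<nu> x \<epsilon> / ereal (- ln \<epsilon>) \<le> ereal u"
      using l(2) by (simp add: l_def)
  qed
  with assms(1) have "ereal s \<le> ereal u" by (rule order.trans)
  then show False using u by simp
qed

lemma upper_mdim_GLW_ge_if_local_mdim_ge:
  assumes "emeasure \<nu> (space \<nu>) \<noteq> 0" "0 < s" and ge: "\<And>x. ereal s \<le> upper_local_mdim S \<nu> x"
  shows "ereal s \<le> upper_mdim_GLW S"
proof (rule ccontr)
  assume "\<not> ?thesis"
  then have "upper_mdim_GLW S < ereal s" by simp
  \<comment> \<open>The maximum with 0 forces the intermediate value \<open>t\<close> to be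
    positive, as \<open>exp_scale_local_entropy\<close> requires.\<close>
  then have "max 0 (upper_mdim_GLW S) < ereal s" using assms(2) by simp
  then obtain t where "max 0 (upper_mdim_GLW S) < ereal t" "ereal t < ereal s"
    using ereal_dense2 by blast
  then have t: "upper_mdim_GLW S < ereal t" "0 < t" "t < s" by auto
  \<comment> \<open>The factor \<open>1 / 2\<close> anticipates
    \<open>large_local_entropy_null\<close>, which compares local entropy at a radius with the
    entropy of the action at half that radius.\<close>
  have "Limsup (at_right 0) (\<lambda>\<epsilon>. entropy_GLW S (1 / 2 * \<epsilon>) / ereal (- ln \<epsilon>)) \<le> upper_mdim_GLW S"
    unfolding upper_mdim_GLW_def by (intro Limsup_rescale_div_ln_le entropy_GLW_nonneg) auto
  also note t(1)
  finally have "\<forall>\<^sub>F \<epsilon> in at_right 0. entropy_GLW S (1 / 2 * \<epsilon>) / ereal (- ln \<epsilon>) < ereal t"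
    by (rule Limsup_lessD)
  moreover have "filterlim (\<lambda>k. exp (- real k)) (at_right 0) sequentially" by real_asymp
  ultimately have "\<forall>\<^sub>F k in sequentially.
      entropy_GLW S (1 / 2 * exp (- real k)) / ereal (- ln (exp (- real k))) < ereal t"
    by (rule eventually_compose_filterlim)
  then have "\<forall>\<^sub>F k in sequentially. entropy_GLW S (exp (- real k) / 2) < ereal (t * real k)"
    using eventually_gt_at_top[of 0]
  proof eventually_elim
    case (elim k)
    then show ?case
      by (cases "entropy_GLW S (exp (- real k) / 2)") (auto simp: field_simps)
  qed
  then obtain K where K: "\<And>k. k \<ge> K \<Longrightarrow> entropy_GLW S (exp (- real k) / 2) < ereal (t * real k)"
    unfolding eventually_sequentially by auto
  have "\<exists>G\<in>null_sets \<nu>. {x. ereal (t * real k) < lower_local_entropy S \<nu> x (exp (- real k))} \<subseteq> G"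
    if "k \<ge> K" for k
    using K[OF that] by (intro large_local_entropy_null) auto
  then obtain G where G: "\<And>k. k \<ge> K \<Longrightarrow> G k \<in> null_sets \<nu>"
      "\<And>k. k \<ge> K \<Longrightarrow> {x. ereal (t * real k) < lower_local_entropy S \<nu> x (exp (- real k))} \<subseteq> G k"
    by metis
  \<comment> \<open>Every point has large local entropy at some scale \<open>k \<ge> K\<close>. The
    scales are countable, so the whole space becomes a null set.\<close>
  have "UNIV \<subseteq> (\<Union>k\<in>{K..}. G k)"
    using exp_scale_local_entropy[OF ge t(2,3), of K] G(2) by fastforce
  moreover have "(\<Union>k\<in>{K..}. G k) \<in> null_sets \<nu>" using G(1) by (intro null_sets_UN') auto
  ultimately have "UNIV \<in> null_sets \<nu>" by (metis top.extremum_uniqueI)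
  then show False using assms(1) by (simp add: space_eq_UNIV null_setsD1)
qed

end

section \<open>Both claims for a finite family of generators\<close>

theorem theorem6:
  fixes g :: "nat \<Rightarrow> 'a::metric_space \<Rightarrow> 'a" and p :: nat
  assumes "compact (UNIV :: 'a set)"
    and "1 \<le> p"
    and "\<And>i. i \<in> {1..p} \<Longrightarrow> continuous_on UNIV (g i)"
    and "minimal_generators (g ` {1..p})"
  shows
    "(\<forall>\<nu> :: 'a measure. sets \<nu> = sets borel \<and> prob_space \<nu> \<and> strongly_homogeneous (g ` {1..p}) \<nu> \<longrightarrow>
        (\<forall>x. upper_mdim_GLW (g ` {1..p}) =
              Limsup (at_right 0)
                (\<lambda>\<epsilon>. upper_local_entropy (g ` {1..p}) \<nu> x \<epsilon> / ereal (- ln \<epsilon>))))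
     \<and> (\<forall>(\<nu> :: 'a measure) (s :: real).
          sets \<nu> = sets borel \<and> emeasure \<nu> (space \<nu>) \<noteq> 0 \<and> 0 < s \<and>
          (INF x. upper_local_mdim (g ` {1..p}) \<nu> x) \<ge> ereal s \<longrightarrow>
          upper_mdim_GLW (g ` {1..p}) \<ge> ereal s)"
proof -
  interpret compact_semigroup_action "g ` {1..p}"
    using assms(1,3) by unfold_locales auto
  have measured: "measured_semigroup_action (g ` {1..p}) \<nu>" if "sets \<nu> = sets borel"
    for \<nu> :: "'a measure"
    using that by unfold_locales
  \<comment> \<open>The bound on the infimum is turned into a bound at every point by
    \<open>le_INF_iff\<close>.\<close>
  show ?thesis
    using measured_semigroup_action.upper_mdim_GLW_eq_if_strongly_homogeneous[OF measured]
      measured_semigroup_action.upper_mdim_GLW_ge_if_local_mdim_ge[OF measured]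
    by (auto simp: le_INF_iff)
qed

end
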